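(* Let $k\geq 2$ be an integer and let $G$ be a connected finite simple graph without isolated vertices such that the average $2$-degree satisfies $m_i\leq k$ for every vertex $i\in V(G)$. Then the maximum degree satisfies $$\Delta(G)\leq k^2-k+1.$$ Moreover, the following are equivalent: (i) $\Delta(G)=k^2-k+1$; (ii) $G$ is the tree $T_k$; (iii) $G$ is a pseudo $k$-regular tree; (iv) $G$ has a vertex $j$ with $d_j=m_j=k$ such that all neighbors of $j$, with exactly one exception, have degree $1$.
   Context: For a vertex $i$, $d_i$ is its degree and $m_i=d_i^{-1}\sum_{j:\, ji\in E(G)} d_j$ is its average $2$-degree. A graph is $k$-harmonic if $m_i=k$ for all vertices $i$, and pseudo $k$-regular if it is $k$-harmonic but not $k$-regular. For $k\geq 2$, $T_k$ is the tree of order $k^3-k^2+k+1$ whose root has degree $k^2-k+1$ and each neighbor of the root has $k-1$ children, all of which are leaves. *)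

theory Defs
  imports Complex_Main "Graph_Theory.Graph_Theory"
begin

text \<open>
  A finite simple graph is an instance of the locale \<^locale>\<open>graph\<close>: each undirected edge is
  represented by its two opposite arcs. Hence the degree of a vertex is its \<^const>\<open>out_degree\<close>.
\<close>

definition neighbors :: "('a, 'b) pre_digraph \<Rightarrow> 'a \<Rightarrow> 'a set" where
  "neighbors G i = {j. j \<rightarrow>\<^bsub>G\<^esub> i}"

definition avg_2_degree :: "('a, 'b) pre_digraph \<Rightarrow> 'a \<Rightarrow> real" where
  "avg_2_degree G i =
     inverse (real (out_degree G i)) * (\<Sum>j\<in>neighbors G i. real (out_degree G j))"

definition max_degree :: "('a, 'b) pre_digraph \<Rightarrow> nat" where
  "max_degree G = Max (out_degree G ` verts G)"

definition no_isolated_vertices :: "('a, 'b) pre_digraph \<Rightarrow> bool" where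
  "no_isolated_vertices G \<longleftrightarrow> (\<forall>i\<in>verts G. out_degree G i \<noteq> 0)"

definition regular_graph :: "nat \<Rightarrow> ('a, 'b) pre_digraph \<Rightarrow> bool" where
  "regular_graph k G \<longleftrightarrow> (\<forall>i\<in>verts G. out_degree G i = k)"

definition harmonic_graph :: "nat \<Rightarrow> ('a, 'b) pre_digraph \<Rightarrow> bool" where
  "harmonic_graph k G \<longleftrightarrow> (\<forall>i\<in>verts G. avg_2_degree G i = real k)"

definition pseudo_regular_graph :: "nat \<Rightarrow> ('a, 'b) pre_digraph \<Rightarrow> bool" where
  "pseudo_regular_graph k G \<longleftrightarrow> harmonic_graph k G \<and> \<not> regular_graph k G"

text \<open>
  The library constants \<^const>\<open>forest\<close> and \<^const>\<open>tree\<close> are unsuitable here: in a symmetric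
  digraph the walk a, b, a along an edge and back counts as a cycle (of length 2). The cycles of
  the underlying simple graph are the directed cycles of length at least 3.
\<close>

definition undirected_tree :: "('a, 'b) pre_digraph \<Rightarrow> bool" where
  "undirected_tree G \<longleftrightarrow>
     Digraph_Component.connected G \<and> \<not> (\<exists>p. pre_digraph.cycle G p \<and> 3 \<le> length p)"

text \<open>
  In \<open>T_tree k\<close> the root is the empty list, its neighbors are the lists \<open>[a]\<close>, and the
  children of \<open>[a]\<close> are the lists \<open>[a, b]\<close>.
\<close>

definition T_tree_down :: "nat \<Rightarrow> nat list rel" where
  "T_tree_down k =
     {([], [a]) | a. a < k^2 - k + 1} \<union>
     {([a], [a, b]) | a b. a < k^2 - k + 1 \<and> b < k - 1}"

definition T_tree :: "nat \<Rightarrow> nat list pair_pre_digraph" where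
  "T_tree k =
     \<lparr> pverts = {[]} \<union> {[a] | a. a < k^2 - k + 1} \<union>
                 {[a, b] | a b. a < k^2 - k + 1 \<and> b < k - 1},
       parcs = T_tree_down k \<union> (T_tree_down k)\<inverse> \<rparr>"

lemma card_verts_T_tree:
  assumes "k \<ge> 2"
  shows "card (verts (with_proj (T_tree k))) = k^3 - k^2 + k + 1"
proof -
  let ?n = "k^2 - k + 1"
  let ?B = "(\<lambda>a. [a]) ` {..<?n}"
  let ?C = "(\<lambda>(a, b). [a, b]) ` ({..<?n} \<times> {..<k - 1})"
  have "verts (with_proj (T_tree k)) = insert [] (?B \<union> ?C)"
    by (auto simp: T_tree_def)
  moreover have "card ?B = ?n"
    by (subst card_image) (auto simp: inj_on_def)
  moreover have "card ?C = ?n * (k - 1)"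
    by (subst card_image) (auto simp: inj_on_def)
  moreover have "card (?B \<union> ?C) = card ?B + card ?C"
    by (rule card_Un_disjoint) auto
  moreover have "[] \<notin> ?B \<union> ?C" by auto
  ultimately have "card (verts (with_proj (T_tree k))) = 1 + ?n + ?n * (k - 1)"
    by simp
  also have "\<dots> = 1 + ?n * k"
    using assms by (cases k) auto
  also have "?n * k = k^3 - k^2 + k"
    by (simp add: algebra_simps power2_eq_square power3_eq_cube diff_mult_distrib2)
  finally show ?thesis by simp
qed

lemma graph_T_tree: "graph (with_proj (T_tree k))"
proof -
  let ?n = "k^2 - k + 1"
  have V: "pverts (T_tree k) = insert [] ((\<lambda>a. [a]) ` {..<?n} \<union>
             (\<lambda>(a, b). [a, b]) ` ({..<?n} \<times> {..<k - 1}))"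
    by (auto simp: T_tree_def)
  have sub: "parcs (T_tree k) \<subseteq> pverts (T_tree k) \<times> pverts (T_tree k)"
    by (auto simp: T_tree_def T_tree_down_def)
  have finV: "finite (pverts (T_tree k))"
    unfolding V by simp
  have finA: "finite (parcs (T_tree k))"
    using sub finV by (meson finite_SigmaI finite_subset)
  have "pair_graph (T_tree k)"
  proof
    show "symmetric (with_proj (T_tree k))"
      by (auto simp: symmetric_def T_tree_def sym_def)
    show "fst e \<noteq> snd e" if "e \<in> parcs (T_tree k)" for e
      using that by (auto simp: T_tree_def T_tree_down_def)
  qed (use sub finV finA in auto)
  then interpret pair_graph "T_tree k" .
  show ?thesis by unfold_locales
qed

end

theory Submission
  imports Defs
begin

text \<open>
  Let \<open>j\<close> be a neighbor of \<open>i\<close>. Among the neighbors of \<open>j\<close>, \<open>i\<close> contributes \<open>d\<^sub>i\<close> to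
  \<open>d\<^sub>j m\<^sub>j \<le> k d\<^sub>j\<close> and the others at least 1 each, so \<open>d\<^sub>i \<le> (k - 1) d\<^sub>j + 1\<close>. Summing over
  all neighbors \<open>j\<close> of \<open>i\<close> and using \<open>m\<^sub>i \<le> k\<close> gives \<open>d\<^sub>i \<le> k\<^sup>2 - k + 1\<close>. If equality holds,
  all these estimates are tight: every neighbor of \<open>i\<close> has degree \<open>k\<close>, and its other neighbors
  are leaves, so by connectedness the graph is \<open>T\<^sub>k\<close>. Conversely, the second vertex of a longest
  path in a \<open>k\<close>-harmonic tree has degree \<open>k\<close>, and all its neighbors but one are leaves; the
  exceptional neighbor then has degree \<open>k\<^sup>2 - (k - 1)\<close>.
\<close>

section \<open>Neighborhoods, degrees and average 2-degrees\<close>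

lemma (in graph) neighbors_sym: "j \<in> neighbors G i \<longleftrightarrow> i \<in> neighbors G j"
  unfolding neighbors_def using arcs_ends_symmetric[OF sym_arcs] by blast

lemma (in graph) neighbors_subset_verts: "neighbors G i \<subseteq> verts G"
  unfolding neighbors_def by (auto dest: adj_in_verts)

lemma (in graph) neighbor_in_verts:
  assumes "j \<in> neighbors G i"
  shows "i \<in> verts G" "j \<in> verts G"
  using assms unfolding neighbors_def by (auto dest: adj_in_verts)

lemma (in graph) finite_neighbors [simp]: "finite (neighbors G i)"
  using finite_subset[OF neighbors_subset_verts finite_verts] .

lemma (in graph) not_self_neighbor [simp]: "i \<notin> neighbors G i"
  unfolding neighbors_def using adj_not_same by blast

text \<open>\<open>neighbors\<close> looks at arcs into \<open>i\<close>, \<open>out_degree\<close>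
  at arcs out of \<open>i\<close>; symmetry reconciles the two, and the absence of parallel arcs
  makes \<open>head\<close> injective on the out-arcs.\<close>

lemma (in graph) out_degree_eq_card_neighbors: "out_degree G i = card (neighbors G i)"
proof -
  have "bij_betw (head G) (out_arcs G i) (neighbors G i)"
  proof (rule bij_betwI')
    show "(head G x = head G y) = (x = y)" if "x \<in> out_arcs G i" "y \<in> out_arcs G i" for x y
      using that no_multi_arcs[of x y] by (auto simp: arc_to_ends_def)
    show "head G x \<in> neighbors G i" if "x \<in> out_arcs G i" for x
      using that neighbors_sym[of "head G x" i]
      by (auto simp: neighbors_def arcs_ends_conv)
    show "\<exists>x\<in>out_arcs G i. y = head G x" if "y \<in> neighbors G i" for y
      using that neighbors_sym[of y i] by (auto simp: neighbors_def arcs_ends_conv)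
  qed
  thus ?thesis unfolding out_degree_def by (rule bij_betw_same_card)
qed

text \<open>Clearing the denominator moves the later counting to natural numbers.\<close>

lemma (in graph) avg_2_degree_le_iff:
  assumes "out_degree G i \<noteq> 0"
  shows "avg_2_degree G i \<le> real k \<longleftrightarrow>
    (\<Sum>j\<in>neighbors G i. out_degree G j) \<le> k * out_degree G i"
proof -
  have "avg_2_degree G i \<le> real k \<longleftrightarrow>
    real (\<Sum>j\<in>neighbors G i. out_degree G j) \<le> real (k * out_degree G i)"
    using assms unfolding avg_2_degree_def by (simp add: field_simps)
  thus ?thesis unfolding of_nat_le_iff .
qed

lemma (in graph) avg_2_degree_eq_iff:
  assumes "out_degree G i \<noteq> 0"
  shows "avg_2_degree G i = real k \<longleftrightarrow>
    (\<Sum>j\<in>neighbors G i. out_degree G j) = k * out_degree G i"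
proof -
  have "avg_2_degree G i = real k \<longleftrightarrow>
    real (\<Sum>j\<in>neighbors G i. out_degree G j) = real (k * out_degree G i)"
    using assms unfolding avg_2_degree_def by (simp add: field_simps)
  thus ?thesis unfolding of_nat_eq_iff .
qed

text \<open>Symmetry turns connectedness into reachability of every vertex from \<open>r\<close>,
  and membership in \<open>S\<close> propagates along a walk.\<close>

lemma (in graph) connected_closed_eq_verts:
  assumes "Digraph_Component.connected G" "r \<in> S" "r \<in> verts G"
    and "\<And>u v. u \<in> S \<Longrightarrow> v \<in> neighbors G u \<Longrightarrow> v \<in> S"
  shows "verts G \<subseteq> S"
proof
  fix v assume "v \<in> verts G"
  hence "r \<rightarrow>\<^sup>* v"
    using assms(1,3) symmetric_connected_imp_strongly_connected[OF sym_arcs]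
    by (auto simp: strongly_connected_def)
  thus "v \<in> S"
  proof (induction rule: reachable_induct)
    case (step x y)
    thus ?case using assms(4)[of x y] neighbors_sym[of y x] by (auto simp: neighbors_def)
  qed (rule assms(2))
qed

section \<open>Cycles, and longest paths in trees\<close>

lemma (in pre_digraph) cas_tail_nth_Suc:
  assumes "cas u p v" "Suc i < length p"
  shows "tail G (p ! Suc i) = head G (p ! i)"
  using assms
proof (induction p arbitrary: u i)
  case (Cons e p)
  thus ?case by (cases i; cases p) auto
qed simp

lemma (in graph) arc_head_neighbor:
  "e \<in> arcs G \<Longrightarrow> head G e \<in> neighbors G (tail G e)"
  using neighbors_sym[of "head G e"] by (auto simp: neighbors_def arcs_ends_conv)

text \<open>\<open>S\<close> is the vertex set of the cycle: the cyclic predecessor and successor of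
  a vertex are neighbors of it, and they differ because the length is at least 3.\<close>

lemma (in graph) cycle_two_neighbors:
  assumes "cycle p" "length p \<ge> 3"
  obtains S where "S \<noteq> {}" "S \<subseteq> verts G"
    "\<And>x. x \<in> S \<Longrightarrow> \<exists>y\<in>S. \<exists>z\<in>S. y \<noteq> z \<and> y \<in> neighbors G x \<and> z \<in> neighbors G x"
proof -
  obtain u where u: "awalk u p u" "distinct (tl (awalk_verts u p))"
    using assms(1) by (auto simp: cycle_def)
  let ?n = "length p" and ?g = "\<lambda>i. head G (p ! i)"
  have ne: "p \<noteq> []" and cas: "cas u p u"
    using assms(2) u(1) by (auto simp: awalk_def)
  have arc: "p ! i \<in> arcs G" if "i < ?n" for i
    using u(1) nth_mem[OF that] unfolding awalk_def by blast
  \<comment> \<open>Dropping the repeated start vertex from \<open>awalk_verts\<close> leaves the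
    list of heads, so the heads enumerate the cycle without repetition.\<close>
  have verts: "awalk_verts u p = tail G (hd p) # map (head G) p"
    using awalk_verts_conv'[OF cas] ne by simp
  hence inj: "?g i = ?g j \<longleftrightarrow> i = j" if "i < ?n" "j < ?n" for i j
    using u(2) that distinct_conv_nth[of "map (head G) p"] by auto
  have first: "tail G (p ! 0) = ?g (?n - 1)"
    using u(1) verts awlast_of_awalk[OF u(1)] ne cas cas_simp[OF ne, of u u]
    by (simp add: last_conv_nth hd_conv_nth last_map)
  have succ: "?g (Suc i mod ?n) \<in> neighbors G (?g i)" if "i < ?n" for i
  proof (cases "Suc i < ?n")
    case True
    thus ?thesis
      using cas_tail_nth_Suc[OF cas True] arc_head_neighbor[OF arc[OF True]] by auto
  next
    case False
    hence "i = ?n - 1" using that by simp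
    thus ?thesis
      using first arc_head_neighbor[OF arc[of 0]] ne by auto
  qed
  show thesis
  proof (rule that[of "?g ` {..<?n}"])
    show "?g ` {..<?n} \<noteq> {}" using ne by auto
    show "?g ` {..<?n} \<subseteq> verts G" using arc by auto
    fix x assume "x \<in> ?g ` {..<?n}"
    then obtain i where i: "i < ?n" "x = ?g i" by auto
    \<comment> \<open>The cyclic predecessor of \<open>i\<close>; index 0 wraps around.\<close>
    define j where "j = (if i = 0 then ?n - 1 else i - 1)"
    have j: "j < ?n" "Suc j mod ?n = i"
      using i(1) by (auto simp: j_def)
    have i': "Suc i mod ?n < ?n" using ne by simp
    \<comment> \<open>If predecessor and successor coincided, the length would divide 2.\<close>
    have "Suc i mod ?n \<noteq> j"
      using i(1) assms(2) by (cases "Suc i < ?n") (auto simp: j_def mod_Suc)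
    hence "?g (Suc i mod ?n) \<noteq> ?g j"
      using inj[OF i' j(1)] by simp
    moreover have "?g j \<in> neighbors G x"
      using succ[OF j(1)] j(2) i(2) neighbors_sym by simp
    ultimately show "\<exists>y\<in>?g ` {..<?n}. \<exists>z\<in>?g ` {..<?n}.
        y \<noteq> z \<and> y \<in> neighbors G x \<and> z \<in> neighbors G x"
      using succ[OF i(1)] i(2) j(1) i' by blast
  qed
qed

text \<open>Otherwise the initial segment up to \<open>w\<close>, closed by the arc from
  \<open>w\<close> to \<open>u\<close>, would be a cycle of length at least 3.\<close>

lemma (in graph) tree_apath_neighbor:
  assumes tree: "undirected_tree G" and p: "apath u (a # p) v"
    and w: "w \<in> neighbors G u" "w \<in> set (awalk_verts u (a # p))"
  shows "w = head G a"
proof -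
  obtain q r where qr: "a # p = q @ r" "awalk u q w"
    using awalk_decomp[OF awalkI_apath[OF p] w(2)] by blast
  have "apath u q (awlast u q)"
    using p apath_append_iff[of u q r v] unfolding qr(1) by blast
  hence q: "apath u q w" using qr(2) by simp
  obtain e where e: "e \<in> arcs G" "tail G e = w" "head G e = u"
    using w(1) unfolding neighbors_def by blast
  have "awalk w (e # q) w" "distinct (tl (awalk_verts w (e # q)))"
    using q e by (auto simp: awalk_Cons_iff apath_def)
  hence "cycle (e # q)" unfolding cycle_def by blast
  hence "length q < 2" using tree by (force simp: undirected_tree_def)
  moreover have "q \<noteq> []" using q w(1) by (auto simp: apath_Nil_iff)
  ultimately obtain b where "q = [b]"
    by (cases q) auto
  thus ?thesis using qr by (auto simp: awalk_simps)
qed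

text \<open>\<open>u\<close>, \<open>x\<close>, \<open>z\<close> are the first three vertices of a
  longest path. A neighbor \<open>y\<close> of \<open>x\<close> other than \<open>z\<close> can
  serve as the first vertex without changing the length, and the first vertex of a longest path is a
  leaf.\<close>

lemma (in graph) tree_penultimate_vertex:
  assumes tree: "undirected_tree G" and "no_isolated_vertices G"
  obtains u x z where "neighbors G u = {x}"
    "\<And>y. y \<in> neighbors G x \<Longrightarrow> y \<noteq> z \<Longrightarrow> out_degree G y = 1"
proof -
  define P where "P = (\<lambda>(u, p, v). apath u p v)"
  obtain u\<^sub>0 where u\<^sub>0: "u\<^sub>0 \<in> verts G"
    using tree symmetric_connected_imp_strongly_connected[OF sym_arcs]
    by (auto simp: undirected_tree_def strongly_connected_def)
  hence "P (u\<^sub>0, [], u\<^sub>0)" by (simp add: P_def apath_Nil_iff)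
  \<comment> \<open>The number of vertices bounds the length of a path, so a longest one
    exists.\<close>
  moreover have "\<forall>t. P t \<longrightarrow> length (fst (snd t)) < Suc (card (verts G))"
    by (auto simp: P_def less_Suc_eq_le intro: length_apath)
  ultimately obtain t where "P t" "\<forall>t'. P t' \<longrightarrow> length (fst (snd t')) \<le> length (fst (snd t))"
    using ex_has_greatest_nat[of P _ "\<lambda>t. length (fst (snd t))"] by blast
  then obtain u p v where p: "apath u p v"
    and longest: "\<And>u' p' v'. apath u' p' v' \<Longrightarrow> length p' \<le> length p"
    by (cases t) (fastforce simp: P_def)
  \<comment> \<open>A neighbor off the path would prolong it.\<close>
  have end_in_path: "w \<in> set (awalk_verts u' p')"
    if p': "apath u' p' v'" "length p' = length p" and w: "w \<in> neighbors G u'" for u' p' v' w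
  proof (rule ccontr)
    assume "w \<notin> set (awalk_verts u' p')"
    moreover obtain e where "e \<in> arcs G" "tail G e = w" "head G e = u'"
      using w unfolding neighbors_def by blast
    ultimately have "apath w (e # p') v'" using p'(1) by (simp add: apath_Cons_iff)
    from longest[OF this] p'(2) show False by simp
  qed
  have ne: "neighbors G w \<noteq> {}" if "w \<in> verts G" for w
    using assms(2) that by (auto simp: no_isolated_vertices_def out_degree_eq_card_neighbors)
  have end_leaf: "neighbors G u' = {head G a}"
    if "apath u' (a # p') v'" "length (a # p') = length p" for u' a p' v'
    using end_in_path[OF that] tree_apath_neighbor[OF tree that(1)] ne[of u'] that(1)
    by (auto simp: apath_Cons_iff)
  have "p \<noteq> []"
  proof
    assume "p = []"
    moreover obtain w where "w \<in> neighbors G u"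
      using ne p by (auto simp: apath_def)
    ultimately show False
      using end_in_path[OF p refl, of w] p not_self_neighbor[of u] by auto
  qed
  then obtain a p' where a: "p = a # p'" by (cases p) auto
  let ?x = "head G a"
  have p': "apath ?x p' v" "a \<in> arcs G" "tail G a = u"
    using p a by (auto simp: apath_Cons_iff)
  \<comment> \<open>A path with a single arc has no third vertex; \<open>u\<close> is then a default
    value.\<close>
  define z where "z = (case p' of [] \<Rightarrow> u | b # _ \<Rightarrow> head G b)"
  show thesis
  proof (rule that)
    show "neighbors G u = {?x}" using end_leaf[of u a p' v] p a by simp
    fix y assume y: "y \<in> neighbors G ?x" "y \<noteq> z"
    have "y \<notin> set (awalk_verts ?x p')"
    proof (cases p')
      case Nil
      thus ?thesis using y by auto
    next
      case (Cons b p'')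
      thus ?thesis
        using tree_apath_neighbor[OF tree, of ?x b p'' v y] p'(1) y by (auto simp: z_def)
    qed
    moreover obtain e where "e \<in> arcs G" "tail G e = y" "head G e = ?x"
      using y(1) unfolding neighbors_def by blast
    ultimately have "apath y (e # p') v" using p'(1) by (simp add: apath_Cons_iff)
    hence "neighbors G y = {head G e}" using end_leaf a by simp
    thus "out_degree G y = 1" by (simp add: out_degree_eq_card_neighbors)
  qed
qed

section \<open>Isomorphisms onto digraphs whose arcs are pairs\<close>

lemma (in nomulti_digraph) digraph_iso_with_projI:
  assumes "bij_betw f (verts G) (pverts H)"
    and "(\<lambda>(u, v). (f u, f v)) ` arcs_ends G = parcs H"
  shows "digraph_iso G (with_proj H)"
proof -
  \<comment> \<open>The vertex map alone determines the arc map; without parallel arcs, this arc map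
    is injective.\<close>
  let ?h = "\<lparr>iso_verts = f, iso_arcs = \<lambda>e. (f (tail G e), f (head G e)),
             iso_head = snd, iso_tail = fst\<rparr>"
  have inj: "inj_on f (verts G)" and img: "f ` verts G = pverts H"
    using assms(1) by (auto simp: bij_betw_def)
  have "inj_on (\<lambda>e. (f (tail G e), f (head G e))) (arcs G)"
    using no_multi_arcs inj
    by (intro inj_onI) (auto simp: arc_to_ends_def inj_on_eq_iff)
  hence "digraph_isomorphism ?h"
    using inj wf_digraph by (simp add: digraph_isomorphism_def)
  moreover have "with_proj H = app_iso ?h G"
    using img assms(2) by (simp add: with_proj_def app_iso_def arcs_ends_conv image_image)
  ultimately show ?thesis unfolding digraph_iso_def by blast
qed

lemma T_tree_root_degree: "out_degree (with_proj (T_tree k)) [] = k^2 - k + 1"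
proof -
  have "out_arcs (with_proj (T_tree k)) [] = (\<lambda>a. ([], [a])) ` {..<k^2 - k + 1}"
    by (auto simp: out_arcs_def T_tree_def T_tree_down_def)
  thus ?thesis unfolding out_degree_def by (simp add: card_image inj_on_def)
qed

section \<open>The bound on the maximum degree\<close>

locale avg_2_degree_bounded = graph G for G :: "('a, 'b) pre_digraph" (structure) +
  fixes k :: nat
  assumes k_ge_2: "k \<ge> 2"
    and conn: "Digraph_Component.connected G"
    and no_isolated: "no_isolated_vertices G"
    and avg_le: "\<forall>i\<in>verts G. avg_2_degree G i \<le> real k"
begin

text \<open>Trades the truncated subtraction \<open>k^2 - k\<close> for a product, which suits
  arithmetic better.\<close>

lemma k_sq_diff: "k^2 - k + 1 = (k - 1) * k + 1"
  by (simp add: power2_eq_square algebra_simps)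

lemma out_degree_pos: "i \<in> verts G \<Longrightarrow> out_degree G i > 0"
  using no_isolated by (simp add: no_isolated_vertices_def)

lemma degree_sum_le:
  assumes "i \<in> verts G"
  shows "(\<Sum>j\<in>neighbors G i. out_degree G j) \<le> k * out_degree G i"
  using assms avg_le out_degree_pos[OF assms] avg_2_degree_le_iff[of i k] by simp

lemma sum_neighbors_remove:
  assumes "j \<in> neighbors G i"
  shows "(\<Sum>l\<in>neighbors G j. out_degree G l) =
    out_degree G i + (\<Sum>l\<in>neighbors G j - {i}. out_degree G l)"
  using assms neighbors_sym by (intro sum.remove) auto

lemma degree_le_neighbor:
  assumes "j \<in> neighbors G i"
  shows "out_degree G i \<le> (k - 1) * out_degree G j + 1"
proof -
  have "(\<Sum>l\<in>neighbors G j - {i}. 1) \<le> (\<Sum>l\<in>neighbors G j - {i}. out_degree G l)"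
    using out_degree_pos neighbor_in_verts by (intro sum_mono) (force simp: Suc_le_eq)
  moreover have "card (neighbors G j - {i}) = out_degree G j - 1"
    using assms neighbors_sym by (simp add: out_degree_eq_card_neighbors)
  ultimately have "out_degree G i + (out_degree G j - 1) \<le> k * out_degree G j"
    using degree_sum_le[OF neighbor_in_verts(2)[OF assms]] sum_neighbors_remove[OF assms] by simp
  thus ?thesis using k_ge_2 by (cases k) auto
qed

text \<open>The bounds of \<open>degree_le_neighbor\<close> in summed form, stated separately
  because both the degree bound and its equality case rest on it.\<close>

lemma neighbor_bound_sum_le:
  assumes "i \<in> verts G"
  shows "(\<Sum>j\<in>neighbors G i. (k - 1) * out_degree G j + 1) \<le> (k^2 - k + 1) * out_degree G i"
proof -
  have "(\<Sum>j\<in>neighbors G i. (k - 1) * out_degree G j + 1) =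
      (k - 1) * (\<Sum>j\<in>neighbors G i. out_degree G j) + out_degree G i"
    by (simp only: sum.distrib sum_distrib_left[symmetric] sum_constant)
      (simp add: out_degree_eq_card_neighbors)
  also have "\<dots> \<le> (k - 1) * (k * out_degree G i) + out_degree G i"
    by (intro add_mono mult_left_mono degree_sum_le assms) auto
  also have "\<dots> = (k^2 - k + 1) * out_degree G i"
    unfolding k_sq_diff by (simp add: algebra_simps)
  finally show ?thesis .
qed

lemma out_degree_le:
  assumes "i \<in> verts G"
  shows "out_degree G i \<le> k^2 - k + 1"
proof -
  \<comment> \<open>The square is a constant summed over the neighbors, so the bound applies term by
    term; one positive factor cancels at the end.\<close>
  have "out_degree G i * out_degree G i = (\<Sum>j\<in>neighbors G i. out_degree G i)"
    by (simp add: out_degree_eq_card_neighbors)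
  also have "\<dots> \<le> (\<Sum>j\<in>neighbors G i. (k - 1) * out_degree G j + 1)"
    by (intro sum_mono degree_le_neighbor)
  also have "\<dots> \<le> (k^2 - k + 1) * out_degree G i"
    by (rule neighbor_bound_sum_le[OF assms])
  finally show ?thesis using out_degree_pos[OF assms] mult_le_cancel2 by blast
qed

lemma verts_nonempty: "verts G \<noteq> {}"
  using symmetric_connected_imp_strongly_connected[OF sym_arcs conn]
  by (simp add: strongly_connected_def)

lemma max_degree_le: "max_degree G \<le> k^2 - k + 1"
  unfolding max_degree_def using verts_nonempty out_degree_le by (subst Max_le_iff) auto

text \<open>Reduces condition (i) to the existence of a vertex attaining the bound, the form with
  which the other conditions are compared.\<close>

lemma max_degree_eq_iff:
  "max_degree G = k^2 - k + 1 \<longleftrightarrow> (\<exists>r\<in>verts G. out_degree G r = k^2 - k + 1)"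
proof
  assume "max_degree G = k^2 - k + 1"
  moreover have "max_degree G \<in> out_degree G ` verts G"
    unfolding max_degree_def using verts_nonempty by (intro Max_in) auto
  ultimately show "\<exists>r\<in>verts G. out_degree G r = k^2 - k + 1" by auto
next
  assume "\<exists>r\<in>verts G. out_degree G r = k^2 - k + 1"
  hence "k^2 - k + 1 \<le> max_degree G"
    unfolding max_degree_def by (metis Max_ge finite_imageI finite_verts imageI)
  with max_degree_le show "max_degree G = k^2 - k + 1" by simp
qed

section \<open>Degrees around a vertex attaining the bound\<close>

lemma extremal_neighbor_degree:
  assumes r: "r \<in> verts G" "out_degree G r = k^2 - k + 1"
    and j: "j \<in> neighbors G r"
  shows "out_degree G j = k"
proof -
  let ?f = "\<lambda>j. (k - 1) * out_degree G j + 1"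
  have "(\<Sum>j\<in>neighbors G r. out_degree G r) = (k^2 - k + 1) * out_degree G r"
    using r(2) by (simp add: out_degree_eq_card_neighbors)
  moreover have "(\<Sum>j\<in>neighbors G r. out_degree G r) \<le> sum ?f (neighbors G r)"
    by (intro sum_mono degree_le_neighbor)
  \<comment> \<open>The sums are squeezed to equality, so the termwise inequalities are equalities
    as well.\<close>
  ultimately have "(\<Sum>j\<in>neighbors G r. out_degree G r) = sum ?f (neighbors G r)"
    using neighbor_bound_sum_le[OF r(1)] by linarith
  hence "out_degree G r = ?f j"
    by (rule sum_mono_inv) (use degree_le_neighbor j in auto)
  hence "(k - 1) * k = (k - 1) * out_degree G j"
    using r(2) unfolding k_sq_diff by simp
  thus ?thesis using k_ge_2 by simp
qed

text \<open>After \<open>r\<close> takes its share of at most \<open>k * k\<close>, only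
  \<open>k - 1\<close> remains for the \<open>k - 1\<close> other neighbors of \<open>j\<close>,
  each of degree at least 1.\<close>

lemma extremal_leaf_degree:
  assumes r: "r \<in> verts G" "out_degree G r = k^2 - k + 1"
    and j: "j \<in> neighbors G r" and l: "l \<in> neighbors G j" "l \<noteq> r"
  shows "out_degree G l = 1"
proof -
  let ?A = "neighbors G j - {r}"
  have dj: "out_degree G j = k"
    using extremal_neighbor_degree[OF r j] .
  have "card ?A = k - 1"
    using dj j neighbors_sym by (simp add: out_degree_eq_card_neighbors)
  moreover have "k^2 - k + 1 + sum (out_degree G) ?A \<le> k * k"
    using degree_sum_le[OF neighbor_in_verts(2)[OF j]] sum_neighbors_remove[OF j] dj r(2) by simp
  moreover have "k * k = (k - 1) * k + k"
    using k_ge_2 by (cases k) auto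
  ultimately have "sum (out_degree G) ?A \<le> (\<Sum>l\<in>?A. 1)"
    unfolding k_sq_diff by simp
  moreover have ge: "1 \<le> out_degree G l" if "l \<in> ?A" for l
    using that out_degree_pos neighbor_in_verts by (force simp: Suc_le_eq)
  hence "(\<Sum>l\<in>?A. 1) \<le> sum (out_degree G) ?A"
    by (rule sum_mono)
  ultimately have "(\<Sum>l\<in>?A. 1) = sum (out_degree G) ?A" by simp
  hence "1 = out_degree G l"
    by (rule sum_mono_inv) (use ge l in auto)
  thus ?thesis by simp
qed

text \<open>Leaves alone would make the average 2-degree 1, which is less than
  \<open>k\<close>.\<close>

lemma not_all_neighbors_leaves:
  assumes "j \<in> verts G" "avg_2_degree G j = real k"
  shows "\<exists>v\<in>neighbors G j. out_degree G v \<noteq> 1"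
proof (rule ccontr)
  assume "\<not> ?thesis"
  hence "(\<Sum>v\<in>neighbors G j. out_degree G v) = out_degree G j"
    by (simp add: out_degree_eq_card_neighbors)
  thus False
    using avg_2_degree_eq_iff[of j k] assms out_degree_pos[of j] k_ge_2 by auto
qed

text \<open>The degrees around \<open>j\<close> sum to \<open>k * k\<close>, of which the
  \<open>k - 1\<close> leaves account for \<open>k - 1\<close>.\<close>

lemma degree_of_unique_nonleaf:
  assumes "j \<in> verts G" "out_degree G j = k" "avg_2_degree G j = real k"
    and v: "v \<in> neighbors G j" and "\<And>l. l \<in> neighbors G j \<Longrightarrow> l \<noteq> v \<Longrightarrow> out_degree G l = 1"
  shows "out_degree G v = k^2 - k + 1"
proof -
  have "j \<in> neighbors G v" using v neighbors_sym by blast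
  note sum_neighbors_remove[OF this]
  moreover have "(\<Sum>l\<in>neighbors G j - {v}. out_degree G l) = k - 1"
    using assms by (simp add: out_degree_eq_card_neighbors)
  moreover have "(\<Sum>l\<in>neighbors G j. out_degree G l) = k * k"
    using assms avg_2_degree_eq_iff[of j k] out_degree_pos[of j] by simp
  moreover have "k * k = (k - 1) * k + 1 + (k - 1)"
    using k_ge_2 by (cases k) auto
  ultimately show ?thesis unfolding k_sq_diff by simp
qed

text \<open>The count of \<open>degree_of_unique_nonleaf\<close> in reverse: \<open>r\<close> and
  the \<open>k - 1\<close> leaves together contribute exactly \<open>k * k\<close>.\<close>

lemma extremal_neighbor_avg:
  assumes r: "r \<in> verts G" "out_degree G r = k^2 - k + 1"
    and j: "j \<in> neighbors G r"
  shows "avg_2_degree G j = real k"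
proof -
  note dj = extremal_neighbor_degree[OF r j]
  have "(\<Sum>l\<in>neighbors G j - {r}. out_degree G l) = k - 1"
    using extremal_leaf_degree[OF r j] dj j neighbors_sym
    by (simp add: out_degree_eq_card_neighbors)
  moreover have "k * k = (k - 1) * k + 1 + (k - 1)"
    using k_ge_2 by (cases k) auto
  ultimately have "(\<Sum>l\<in>neighbors G j. out_degree G l) = k * k"
    using r(2) sum_neighbors_remove[OF j] unfolding k_sq_diff by simp
  thus ?thesis
    using avg_2_degree_eq_iff[of j k] dj k_ge_2 by simp
qed

text \<open>Condition (iv): the exceptional neighbor attains the bound, and conversely any neighbor
  of an extremal vertex can serve as \<open>j\<close>.\<close>

lemma extremal_iff_penultimate:
  "(\<exists>r\<in>verts G. out_degree G r = k^2 - k + 1) \<longleftrightarrow>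
   (\<exists>j\<in>verts G. out_degree G j = k \<and> avg_2_degree G j = real k \<and>
      (\<exists>!v. v \<in> neighbors G j \<and> out_degree G v \<noteq> 1))"
  (is "?L \<longleftrightarrow> ?R")
proof
  assume ?R
  then obtain j v where "j \<in> verts G" "out_degree G j = k" "avg_2_degree G j = real k"
    "v \<in> neighbors G j" "\<And>l. l \<in> neighbors G j \<Longrightarrow> l \<noteq> v \<Longrightarrow> out_degree G l = 1"
    by blast
  thus ?L using degree_of_unique_nonleaf neighbor_in_verts(2) by (intro bexI[of _ v]) simp_all
next
  assume ?L
  then obtain r where r: "r \<in> verts G" "out_degree G r = k^2 - k + 1" by blast
  hence "neighbors G r \<noteq> {}"
    by (auto simp: out_degree_eq_card_neighbors)
  then obtain j where j: "j \<in> neighbors G r" by blast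
  note dj = extremal_neighbor_degree[OF r j] and leaf = extremal_leaf_degree[OF r j]
  \<comment> \<open>So \<open>r\<close> itself is the one exceptional neighbor of
    \<open>j\<close>.\<close>
  have "out_degree G r \<noteq> 1"
    using k_ge_2 unfolding r(2) k_sq_diff by simp
  hence "\<exists>!v. v \<in> neighbors G j \<and> out_degree G v \<noteq> 1"
    using leaf j neighbors_sym by blast
  thus ?R using dj extremal_neighbor_avg[OF r j] neighbor_in_verts(2)[OF j] by blast
qed

section \<open>Global structure of an extremal graph\<close>

lemma extremal_verts:
  assumes r: "r \<in> verts G" "out_degree G r = k^2 - k + 1"
  shows "verts G = insert r (neighbors G r \<union> (\<Union>j\<in>neighbors G r. neighbors G j - {r}))"
    (is "_ = ?S")
proof
  show "?S \<subseteq> verts G" using r(1) neighbors_subset_verts by blast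
  show "verts G \<subseteq> ?S"
  proof (rule connected_closed_eq_verts[OF conn _ r(1)])
    fix u v assume u: "u \<in> ?S" and v: "v \<in> neighbors G u"
    consider "u = r" | "u \<in> neighbors G r" | j where "j \<in> neighbors G r" "u \<in> neighbors G j" "u \<noteq> r"
      using u by blast
    thus "v \<in> ?S"
    proof cases
      \<comment> \<open>A vertex of the last layer is a leaf, so its only neighbor is the
        \<open>j\<close> through which it was reached.\<close>
      case 3
      hence "card (neighbors G u) = 1"
        using extremal_leaf_degree[OF r] out_degree_eq_card_neighbors by metis
      hence "v = j" using v 3(2) neighbors_sym[of u j] by (auto simp: card_1_singleton_iff)
      thus ?thesis using 3(1) by simp
    qed (use v in auto)
  qed simp
qed

lemma extremal_leaf_neighbors:
  assumes r: "r \<in> verts G" "out_degree G r = k^2 - k + 1"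
    and j: "j \<in> neighbors G r" and l: "l \<in> neighbors G j" "l \<noteq> r"
  shows "neighbors G l = {j}"
proof -
  have "card (neighbors G l) = 1"
    using extremal_leaf_degree[OF assms] by (simp add: out_degree_eq_card_neighbors)
  thus ?thesis using l(1) neighbors_sym[of l j] by (auto simp: card_1_singleton_iff)
qed

text \<open>The layers are disjoint: neighbors of \<open>r\<close> have degree \<open>k\<close>, at
  least 2, whereas the vertices beyond them have degree 1.\<close>

lemma extremal_vert_cases:
  assumes r: "r \<in> verts G" "out_degree G r = k^2 - k + 1" and v: "v \<in> verts G"
  obtains (root) "v = r"
  | (inner) "v \<in> neighbors G r" "v \<noteq> r" "out_degree G v = k"
  | (leaf) j where "j \<in> neighbors G r" "v \<in> neighbors G j - {r}" "v \<noteq> r" "v \<notin> neighbors G r"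
      "neighbors G v = {j}" "out_degree G v = 1"
proof -
  consider "v = r" | "v \<in> neighbors G r"
    | j where "j \<in> neighbors G r" "v \<in> neighbors G j" "v \<noteq> r"
    using v extremal_verts[OF r] by blast
  thus thesis
  proof cases
    case 2
    moreover from this have "v \<noteq> r" by auto
    ultimately show ?thesis using extremal_neighbor_degree[OF r] inner by blast
  next
    case (3 j)
    hence "out_degree G v = 1" by (rule extremal_leaf_degree[OF r])
    moreover from this have "v \<notin> neighbors G r"
      using extremal_neighbor_degree[OF r] k_ge_2 by force
    ultimately show ?thesis using leaf[of j] 3 extremal_leaf_neighbors[OF r 3] by blast
  qed (use root in blast)
qed

text \<open>The root and the leaves see only vertices of degree \<open>k\<close>; regularity fails
  at the root, whose degree exceeds \<open>k\<close>.\<close>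

lemma extremal_pseudo_regular:
  assumes r: "r \<in> verts G" "out_degree G r = k^2 - k + 1"
  shows "pseudo_regular_graph k G"
proof -
  have "avg_2_degree G v = real k" if "v \<in> verts G" for v
    using r that
  proof (cases rule: extremal_vert_cases)
    case root
    have "(\<Sum>j\<in>neighbors G r. out_degree G j) = k * out_degree G r"
      using extremal_neighbor_degree[OF r] by (simp add: out_degree_eq_card_neighbors)
    thus ?thesis using root avg_2_degree_eq_iff[of r k] r by simp
  next
    case inner
    thus ?thesis using extremal_neighbor_avg[OF r] by simp
  next
    case (leaf j)
    thus ?thesis using avg_2_degree_eq_iff[of v k] extremal_neighbor_degree[OF r] by simp
  qed
  moreover have "out_degree G r \<noteq> k"
  proof -
    have "1 * k \<le> (k - 1) * k" using k_ge_2 by (intro mult_right_mono) auto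
    thus ?thesis unfolding r(2) k_sq_diff by linarith
  qed
  ultimately show ?thesis
    using r(1) by (auto simp: pseudo_regular_graph_def harmonic_graph_def regular_graph_def)
qed

text \<open>On a cycle every vertex has two neighbors on the cycle. This excludes the leaves, then
  the neighbors of \<open>r\<close>, then \<open>r\<close>.\<close>

lemma extremal_undirected_tree:
  assumes r: "r \<in> verts G" "out_degree G r = k^2 - k + 1"
  shows "undirected_tree G"
proof -
  have False if p: "cycle p" "3 \<le> length p" for p
  proof -
    obtain S where S: "S \<noteq> {}" "S \<subseteq> verts G"
      and two: "\<And>x. x \<in> S \<Longrightarrow> \<exists>y\<in>S. \<exists>z\<in>S. y \<noteq> z \<and> y \<in> neighbors G x \<and> z \<in> neighbors G x"
      using cycle_two_neighbors[OF p] by blast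
    have no_leaf: "x \<notin> S" if "j \<in> neighbors G r" "x \<in> neighbors G j" "x \<noteq> r" for j x
      using two[of x] extremal_leaf_neighbors[OF r that] by auto
    have no_inner: "j \<notin> S" if "j \<in> neighbors G r" for j
      using two[of j] no_leaf[OF that] by metis
    obtain x where x: "x \<in> S" using S by blast
    have "x = r" using no_leaf no_inner x S(2) extremal_verts[OF r] by blast
    thus False using two[OF x] no_inner by blast
  qed
  thus ?thesis using conn unfolding undirected_tree_def by blast
qed

section \<open>Isomorphism with \<open>T_tree k\<close>\<close>

lemma extremal_iso_T_tree:
  assumes r: "r \<in> verts G" "out_degree G r = k^2 - k + 1"
  shows "digraph_iso G (with_proj (T_tree k))"
proof -
  let ?n = "k^2 - k + 1" and ?C = "\<lambda>j. neighbors G j - {r}"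
  obtain g where g: "bij_betw g (neighbors G r) {..<?n}"
    using finite_same_card_bij[of "neighbors G r" "{..<?n}"] r(2)
    by (auto simp: out_degree_eq_card_neighbors)
  have "\<exists>h. bij_betw h (?C j) {..<k - 1}" if "j \<in> neighbors G r" for j
    using finite_same_card_bij[of "?C j" "{..<k - 1}"] extremal_neighbor_degree[OF r that]
      that neighbors_sym by (simp add: out_degree_eq_card_neighbors)
  then obtain h where h: "\<And>j. j \<in> neighbors G r \<Longrightarrow> bij_betw (h j) (?C j) {..<k - 1}"
    by metis
  \<comment> \<open>Meant for leaves, whose neighborhood is a singleton.\<close>
  define parent where "parent l = the_elem (neighbors G l)" for l
  \<comment> \<open>Each vertex goes to the labels met on the way from the root: \<open>g\<close>
    numbers the neighbors of \<open>r\<close>, and \<open>h j\<close> the children of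
    \<open>j\<close>.\<close>
  define f where "f v = (if v = r then [] else if v \<in> neighbors G r then [g v]
    else [g (parent v), h (parent v) v])" for v
  have f_root: "f r = []" by (simp add: f_def)
  have f_inner: "f j = [g j]" if "j \<in> neighbors G r" for j
    using that not_self_neighbor by (auto simp: f_def)
  have f_leaf: "f l = [g j, h j l]" if "j \<in> neighbors G r" "l \<in> ?C j" for j l
  proof -
    have "out_degree G l = 1"
      using extremal_leaf_degree[OF r that(1)] that(2) by blast
    hence "l \<notin> neighbors G r"
      using extremal_neighbor_degree[OF r] k_ge_2 by force
    thus ?thesis
      using that extremal_leaf_neighbors[OF r that(1), of l] by (auto simp: f_def parent_def)
  qed
  have g_img: "g ` neighbors G r = {..<?n}" and g_inj: "inj_on g (neighbors G r)"
    using g by (auto simp: bij_betw_def)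
  have h_img: "h j ` ?C j = {..<k - 1}" and h_inj: "inj_on (h j) (?C j)"
    if "j \<in> neighbors G r" for j
    using h[OF that] by (auto simp: bij_betw_def)
  have inj: "inj_on f (verts G)"
  proof (rule inj_onI)
    \<comment> \<open>The length of \<open>f v\<close> reveals the layer of \<open>v\<close>; within
      a layer, injectivity of \<open>g\<close> and then of \<open>h j\<close> decides.\<close>
    fix u v assume u: "u \<in> verts G" and v: "v \<in> verts G" and eq: "f u = f v"
    from r u show "u = v"
    proof (cases rule: extremal_vert_cases)
      case root
      from r v show ?thesis
        by (cases rule: extremal_vert_cases) (use root eq f_root f_inner f_leaf in auto)
    next
      case inner
      from r v show ?thesis
        by (cases rule: extremal_vert_cases)
          (use inner eq f_root f_inner f_leaf g_inj in \<open>auto dest: inj_onD\<close>)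
    next
      case (leaf j)
      note u = leaf f_leaf[OF leaf(1,2)]
      from r v show ?thesis
      proof (cases rule: extremal_vert_cases)
        case (leaf i)
        hence "g j = g i" "h j u = h i v" using u f_leaf[OF leaf(1,2)] eq by auto
        hence "j = i" using g_inj u(1) leaf(1) by (auto dest: inj_onD)
        thus ?thesis using \<open>h j u = h i v\<close> h_inj[OF u(1)] u(2) leaf(2) by (auto dest: inj_onD)
      qed (use u eq f_root f_inner in auto)
    qed
  qed
  \<comment> \<open>The image is computed layer by layer.\<close>
  have "f ` verts G = insert [] (f ` neighbors G r \<union> (\<Union>j\<in>neighbors G r. f ` ?C j))"
    unfolding extremal_verts[OF r] using f_root by auto
  also have "f ` neighbors G r = (\<lambda>a. [a]) ` {..<?n}"
    unfolding g_img[symmetric] image_image using f_inner by (rule image_cong[OF refl])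
  also have "(\<Union>j\<in>neighbors G r. f ` ?C j) = (\<Union>j\<in>neighbors G r. (\<lambda>b. [g j, b]) ` {..<k - 1})"
  proof (rule SUP_cong[OF refl])
    fix j assume j: "j \<in> neighbors G r"
    show "f ` ?C j = (\<lambda>b. [g j, b]) ` {..<k - 1}"
      unfolding h_img[OF j, symmetric] image_image using f_leaf[OF j] by (rule image_cong[OF refl])
  qed
  also have "\<dots> = (\<Union>a\<in>{..<?n}. (\<lambda>b. [a, b]) ` {..<k - 1})"
    unfolding g_img[symmetric] by simp
  also have "insert [] ((\<lambda>a. [a]) ` {..<?n} \<union> \<dots>) = pverts (T_tree k)"
    by (auto simp: T_tree_def)
  finally have "bij_betw f (verts G) (pverts (T_tree k))"
    using inj by (simp add: bij_betw_def)
  moreover have "(\<lambda>(u, v). (f u, f v)) ` arcs_ends G = parcs (T_tree k)"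
  proof (intro equalityI subsetI)
    fix e assume "e \<in> (\<lambda>(u, v). (f u, f v)) ` arcs_ends G"
    then obtain u v where e: "e = (f u, f v)" and uv: "u \<in> neighbors G v" "v \<in> neighbors G u"
      using neighbors_sym by (auto simp: neighbors_def)
    \<comment> \<open>Arcs leading away from the root go to \<open>T_tree_down k\<close>; every arc
      is of this kind or the reverse of one.\<close>
    have down: "(f x, f y) \<in> T_tree_down k"
      if "x = r \<and> y \<in> neighbors G r \<or> x \<in> neighbors G r \<and> y \<in> ?C x" for x y
    proof -
      have "g j < ?n" "l \<in> ?C j \<Longrightarrow> h j l < k - 1" if "j \<in> neighbors G r" for j l
        using g_img h_img[OF that] that by blast+
      thus ?thesis using that f_root f_inner f_leaf by (auto simp: T_tree_down_def)
    qed
    have "(f u, f v) \<in> T_tree_down k \<or> (f v, f u) \<in> T_tree_down k"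
      using r neighbor_in_verts(2)[OF uv(1)]
    proof (cases rule: extremal_vert_cases)
      case root
      thus ?thesis using down[of u v] uv by blast
    next
      case inner
      thus ?thesis using down[of u v] down[of v u] uv by blast
    next
      case (leaf j)
      moreover from this have "v = j" using uv(2) by simp
      ultimately show ?thesis using down[of v u] by blast
    qed
    thus "e \<in> parcs (T_tree k)" using e by (simp add: T_tree_def)
  next
    fix e assume e: "e \<in> parcs (T_tree k)"
    \<comment> \<open>Preimages are found for downward arcs; symmetry of \<open>neighbors\<close>
      supplies the upward ones.\<close>
    have down: "\<exists>u v. v \<in> neighbors G u \<and> x = f u \<and> y = f v"
      if xy: "(x, y) \<in> T_tree_down k" for x y
    proof -
      have g_ex: "\<exists>j\<in>neighbors G r. a = g j" if "a < ?n" for a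
        using that g_img by blast
      consider a where "a < ?n" "x = []" "y = [a]"
        | a b where "a < ?n" "b < k - 1" "x = [a]" "y = [a, b]"
        using xy by (auto simp: T_tree_down_def)
      thus ?thesis
      proof cases
        case 1
        thus ?thesis using g_ex f_root f_inner by metis
      next
        case 2
        then obtain j where j: "j \<in> neighbors G r" "a = g j" using g_ex by blast
        obtain l where "l \<in> ?C j" "b = h j l" using h_img[OF j(1)] 2(2) by blast
        thus ?thesis using j f_inner f_leaf 2 by (metis DiffD1)
      qed
    qed
    obtain x y where xy: "e = (x, y)" by (cases e)
    hence "\<exists>u v. v \<in> neighbors G u \<and> x = f u \<and> y = f v"
      using e down[of x y] down[of y x] neighbors_sym by (auto simp: T_tree_def)
    then obtain u v where "u \<in> neighbors G v" "x = f u" "y = f v"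
      using neighbors_sym by blast
    thus "e \<in> (\<lambda>(u, v). (f u, f v)) ` arcs_ends G"
      using xy by (force simp: neighbors_def)
  qed
  ultimately show ?thesis by (rule digraph_iso_with_projI)
qed

section \<open>The equivalences\<close>

lemma extremal_iff_T_tree:
  "(\<exists>r\<in>verts G. out_degree G r = k^2 - k + 1) \<longleftrightarrow> digraph_iso G (with_proj (T_tree k))"
proof
  assume "digraph_iso G (with_proj (T_tree k))"
  then obtain h where h: "digraph_isomorphism h" "with_proj (T_tree k) = app_iso h G"
    unfolding digraph_iso_def by blast
  have "[] \<in> verts (with_proj (T_tree k))" by (simp add: T_tree_def)
  then obtain r where "r \<in> verts G" "iso_verts h r = []"
    unfolding h(2) by auto
  \<comment> \<open>An isomorphism preserves out-degrees, so the preimage of the root attains the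
    bound.\<close>
  thus "\<exists>r\<in>verts G. out_degree G r = k^2 - k + 1"
    using out_degree_app_iso_eq[OF h(1), of r] T_tree_root_degree[of k] h(2) by auto
qed (use extremal_iso_T_tree in blast)

text \<open>For the direction from trees, the second vertex of a longest path is shown to satisfy
  condition (iv).\<close>

lemma extremal_iff_pseudo_regular_tree:
  "(\<exists>r\<in>verts G. out_degree G r = k^2 - k + 1) \<longleftrightarrow>
   pseudo_regular_graph k G \<and> undirected_tree G"
proof
  assume R: "pseudo_regular_graph k G \<and> undirected_tree G"
  hence avg: "avg_2_degree G i = real k" if "i \<in> verts G" for i
    using that by (simp add: pseudo_regular_graph_def harmonic_graph_def)
  obtain u x z where u: "neighbors G u = {x}"
    and leaf: "\<And>y. y \<in> neighbors G x \<Longrightarrow> y \<noteq> z \<Longrightarrow> out_degree G y = 1"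
    using tree_penultimate_vertex R no_isolated by metis
  have verts: "u \<in> verts G" "x \<in> verts G" using neighbor_in_verts[of x u] u by auto
  \<comment> \<open>As \<open>u\<close> is a leaf, its average 2-degree is the degree of its only
    neighbor.\<close>
  have "out_degree G x = k"
    using avg[OF verts(1)] avg_2_degree_eq_iff[of u k] out_degree_pos[OF verts(1)] u
    by (simp add: out_degree_eq_card_neighbors)
  moreover have "\<exists>!v. v \<in> neighbors G x \<and> out_degree G v \<noteq> 1"
    using leaf not_all_neighbors_leaves[OF verts(2) avg[OF verts(2)]] by blast
  ultimately show "\<exists>r\<in>verts G. out_degree G r = k^2 - k + 1"
    unfolding extremal_iff_penultimate using verts(2) avg by blast
qed (use extremal_pseudo_regular extremal_undirected_tree in blast)

end

theorem theorem4p7: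
  fixes k :: nat and G :: "('a, 'b) pre_digraph"
  assumes "k \<ge> 2"
    and "graph G"
    and "Digraph_Component.connected G"
    and "no_isolated_vertices G"
    and "\<forall>i\<in>verts G. avg_2_degree G i \<le> real k"
  shows "max_degree G \<le> k^2 - k + 1 \<and>
    (max_degree G = k^2 - k + 1 \<longleftrightarrow> digraph_iso G (with_proj (T_tree k))) \<and>
    (max_degree G = k^2 - k + 1 \<longleftrightarrow> pseudo_regular_graph k G \<and> undirected_tree G) \<and>
    (max_degree G = k^2 - k + 1 \<longleftrightarrow>
       (\<exists>j\<in>verts G. out_degree G j = k \<and> avg_2_degree G j = real k \<and>
          (\<exists>!v. v \<in> neighbors G j \<and> out_degree G v \<noteq> 1)))"
proof -
  interpret avg_2_degree_bounded G k
    using assms by (intro avg_2_degree_bounded.intro avg_2_degree_bounded_axioms.intro)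
  \<comment> \<open>Every condition is folded back to the existence of a vertex of degree
    \<open>k^2 - k + 1\<close>, which leaves only the bound.\<close>
  show ?thesis
    unfolding max_degree_eq_iff extremal_iff_T_tree[symmetric]
      extremal_iff_pseudo_regular_tree[symmetric] extremal_iff_penultimate[symmetric]
    using max_degree_le by blast
qed

end
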